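(* Let $f: \mathbb{N} \to [0,\infty)$ be a non-increasing function satisfying \[ \lim_{q \to \infty} f(q) = 0, \qquad \sum_{q=1}^\infty f(q) = \infty. \] Then there exists $S \subseteq \mathbb{N}$ such that \[ \sum_{q \in S} f(q) = \infty, \qquad \lambda(W(f \mathbf{1}_S)) = 0. \]
   Context: $\mathbb{N}$ denotes the positive integers and $\lambda$ denotes Lebesgue measure on $\mathbb{R}$. For $x \in \mathbb{R}$, $\|x\| = \min\{|x-a| : a \in \mathbb{Z}\}$. For $\psi: \mathbb{N} \to [0,\infty)$, \[ W(\psi) = \{\alpha \in [0,1] : \|q\alpha\| < \psi(q) \text{ for infinitely many } q \in \mathbb{N}\}. \] $\mathbf{1}_S$ denotes the indicator function of $S$, and $f\mathbf{1}_S$ is the pointwise product. *)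

theory Defs
  imports "HOL-Analysis.Analysis"
begin

definition int_dist :: "real \<Rightarrow> real"
  where "int_dist x = (INF a::int. \<bar>x - of_int a\<bar>)"

(* The infimum in int_dist is attained, so int_dist x = min {|x - a| : a an integer}. *)
lemma int_dist_is_minimum:
  "\<exists>a::int. int_dist x = \<bar>x - of_int a\<bar> \<and> (\<forall>b::int. \<bar>x - of_int a\<bar> \<le> \<bar>x - of_int b\<bar>)"
proof -
  have min: "\<bar>x - of_int (round x)\<bar> \<le> \<bar>x - of_int b\<bar>" for b :: int
    using round_diff_minimal[of x b] by simp
  have "int_dist x = \<bar>x - of_int (round x)\<bar>"
    unfolding int_dist_def
    by (rule cInf_eq_minimum) (use min in auto)
  with min show ?thesis by blast
qed

(* The positive integers are rendered as {1..} inside nat; the value of psi at 0 is irrelevant. *)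
definition approx_set :: "(nat \<Rightarrow> real) \<Rightarrow> real set"
  where "approx_set \<psi> = {\<alpha> \<in> {0..1}. infinite {q \<in> {1..}. int_dist (of_nat q * \<alpha>) < \<psi> q}}"

end

theory Submission
  imports Defs "HOL-Number_Theory.Cong" "HOL-Computational_Algebra.Primes"
begin

text \<open>
  By Borel--Cantelli it suffices to find, for every \<open>e > 0\<close> and \<open>k\<close>, a finite block \<open>T\<close> of integers
  beyond \<open>k\<close> such that \<open>f\<close> has sum at least \<open>1\<close> over \<open>T\<close> although the set of \<open>\<alpha>\<close> with
  \<open>\<parallel>q\<alpha>\<parallel> < f q\<close> for some \<open>q \<in> T\<close> has measure at most \<open>e\<close> (lemma \<open>exists_block\<close>); the set \<open>S\<close> is the
  union of such blocks with \<open>e = 2^-k\<close>.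

  To build a block, fix finitely many disjoint pairs of primes \<open>b j < a j\<close>, call \<open>m\<close> admissible if
  each pair has a member dividing \<open>m\<close>, and let \<open>T\<close> consist of the products \<open>N * m\<close> with \<open>m \<le> B\<close>
  admissible. The point is that many of the fractions \<open>c / (N * m)\<close> are redundant: if \<open>a j\<close> divides
  both \<open>m\<close> and \<open>c\<close>, then replacing the factor \<open>a j\<close> by \<open>b j\<close> in both gives the same fraction with the
  smaller admissible number \<open>m * b j / a j\<close>, and since \<open>f\<close> is non-increasing the interval around it
  belonging to the smaller denominator contains the other one (\<open>hits_subset_new_intervals\<close>). So only
  the numerators \<open>c\<close> divisible by none of the \<open>a j\<close> that divide \<open>m\<close> matter, and their proportion is
  the product \<open>\<rho> m\<close> of \<open>1 - 1 / a j\<close> over those \<open>j\<close>. The measure is thus at most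
  \<open>4 * (\<Sum>m. f (N * m) * \<rho> m)\<close> (\<open>hits_measure_le\<close>).

  Both admissibility and \<open>\<rho>\<close> are periodic, and the Chinese remainder theorem shows that the mean of
  \<open>\<rho>\<close> over the admissible residues is the product of \<open>1 - b j / (a j * (a j + b j - 1))\<close>
  (\<open>sum_new_density_period\<close>). With consecutive primes as pairs this product tends to \<open>0\<close>, because
  the reciprocals of the primes have a divergent sum (\<open>prime_pairs_product_small\<close>). Partial summation
  passes from the mean over a period to the weights \<open>f (N * m)\<close> with an error of order \<open>f N\<close> times
  the period (\<open>weighted_new_density_le\<close>). As the pairs are fixed before \<open>N\<close> is chosen, and
  \<open>f\<close> tends to \<open>0\<close>, a large \<open>N\<close> makes this error negligible. Finally all multiples of the period are
  admissible, so \<open>f\<close> has an infinite sum over the numbers \<open>N * m\<close>, and \<open>B\<close> can be chosen so that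
  the block has \<open>f\<close>-sum between \<open>1\<close> and \<open>2\<close>.
\<close>

section \<open>Averages of periodic functions\<close>

text \<open>Periodicity with period \<open>A\<close> is expressed as \<open>F (m mod A) = F m\<close>. The identity is the Chinese
  remainder theorem: \<open>m \<mapsto> (m mod A, m mod b)\<close> is a bijection of a period onto pairs of residues.\<close>

lemma sum_mult_periodic:
  fixes F h :: "nat \<Rightarrow> real"
  assumes "coprime A b" "A > 0" "b > 0"
    and F: "\<And>m. F (m mod A) = F m" and h: "\<And>m. h (m mod b) = h m"
  shows "(\<Sum>m<A * b. F m * h m) = (\<Sum>m<A. F m) * (\<Sum>m<b. h m)"
proof -
  let ?r = "\<lambda>m. (m mod A, m mod b)"
  have inj: "inj_on ?r {..<A * b}"
  proof (rule inj_onI)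
    fix x y assume "x \<in> {..<A * b}" "y \<in> {..<A * b}" "?r x = ?r y"
    then have "[x = y] (mod A)" "[x = y] (mod b)"
      by (auto simp: cong_def)
    with \<open>coprime A b\<close> have "[x = y] (mod A * b)"
      by (simp add: coprime_cong_mult_nat)
    with \<open>x \<in> _\<close> \<open>y \<in> _\<close> show "x = y"
      by (auto simp: cong_def)
  qed
  have "?r ` {..<A * b} \<subseteq> {..<A} \<times> {..<b}"
    using assms by auto
  moreover have "card (?r ` {..<A * b}) = card ({..<A} \<times> {..<b})"
    by (simp add: card_image[OF inj])
  ultimately have "?r ` {..<A * b} = {..<A} \<times> {..<b}"
    by (intro card_subset_eq) auto
  with inj have bij: "bij_betw ?r {..<A * b} ({..<A} \<times> {..<b})"
    by (simp add: bij_betw_def)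
  have "(\<Sum>m<A * b. F m * h m) = (\<Sum>m<A * b. (case ?r m of (x, y) \<Rightarrow> F x * h y))"
    by (simp add: F h)
  also have "\<dots> = (\<Sum>(x, y)\<in>{..<A} \<times> {..<b}. F x * h y)"
    by (rule sum.reindex_bij_betw[OF bij])
  also have "\<dots> = (\<Sum>m<A. F m) * (\<Sum>m<b. h m)"
    by (simp add: sum_product sum.cartesian_product)
  finally show ?thesis .
qed

lemma prod_periodic:
  fixes h :: "'i \<Rightarrow> nat \<Rightarrow> real"
  assumes "finite I" and h: "\<And>i m. i \<in> I \<Longrightarrow> h i (m mod b i) = h i m"
  shows "(\<Prod>i\<in>I. h i (m mod (\<Prod>i\<in>I. b i))) = (\<Prod>i\<in>I. h i m)"
proof (rule prod.cong[OF refl])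
  fix i assume i: "i \<in> I"
  then have "b i dvd (\<Prod>i\<in>I. b i)"
    using \<open>finite I\<close> by (rule dvd_prodI[rotated])
  then show "h i (m mod (\<Prod>i\<in>I. b i)) = h i m"
    by (metis h[OF i] mod_mod_cancel)
qed

lemma sum_prod_periodic:
  fixes h :: "'i \<Rightarrow> nat \<Rightarrow> real"
  assumes "finite I" and "\<And>i. i \<in> I \<Longrightarrow> b i > 0"
    and "\<And>i m. i \<in> I \<Longrightarrow> h i (m mod b i) = h i m"
    and "\<And>i j. i \<in> I \<Longrightarrow> j \<in> I \<Longrightarrow> i \<noteq> j \<Longrightarrow> coprime (b i) (b j)"
  shows "(\<Sum>m<(\<Prod>i\<in>I. b i). \<Prod>i\<in>I. h i m) = (\<Prod>i\<in>I. \<Sum>m<b i. h i m)"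
  using assms
proof (induction I rule: finite_induct)
  case empty
  then show ?case by (simp add: lessThan_Suc)
next
  case (insert x I)
  have "(\<Sum>m<(\<Prod>i\<in>I. b i) * b x. (\<Prod>i\<in>I. h i m) * h x m)
      = (\<Sum>m<(\<Prod>i\<in>I. b i). \<Prod>i\<in>I. h i m) * (\<Sum>m<b x. h x m)"
  proof (rule sum_mult_periodic)
    show "coprime (\<Prod>i\<in>I. b i) (b x)"
      using insert.prems(3) insert.hyps(2) by (intro prod_coprime_left) auto
    show "0 < (\<Prod>i\<in>I. b i)"
      using insert.prems(1) by (intro prod_pos) auto
    show "(\<Prod>i\<in>I. h i (m mod (\<Prod>i\<in>I. b i))) = (\<Prod>i\<in>I. h i m)" for m
      using insert by (intro prod_periodic) auto
  qed (use insert.prems in auto)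
  moreover have "(\<Sum>m<(\<Prod>i\<in>I. b i). \<Prod>i\<in>I. h i m) = (\<Prod>i\<in>I. \<Sum>m<b i. h i m)"
    using insert.prems by (intro insert.IH) auto
  ultimately show ?case
    using insert.hyps by (simp add: mult.commute)
qed

lemma sum_periods:
  fixes F :: "nat \<Rightarrow> real"
  assumes "\<And>m. F (m mod A) = F m"
  shows "(\<Sum>m<k * A. F m) = real k * (\<Sum>m<A. F m)"
proof -
  have "(\<Sum>m = i * A..<i * A + A. F m) = (\<Sum>m<A. F m)" for i
  proof -
    have "(\<Sum>m = i * A..<i * A + A. F m) = (\<Sum>m<A. F (m + i * A))"
      using sum.shift_bounds_nat_ivl[of F 0 "i * A" A] by (simp add: atLeast0LessThan add.commute)
    also have "\<dots> = (\<Sum>m<A. F m)"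
      by (metis assms mod_mult_self1)
    finally show ?thesis .
  qed
  then show ?thesis
    using sum.nat_group[of F A k] by simp
qed

lemma sum_multiples_indicator:
  fixes d :: nat assumes "d > 0"
  shows "(\<Sum>m<k * d. of_bool (d dvd m) :: real) = real k"
proof -
  have "(\<Sum>m<d. of_bool (d dvd m) :: real) = (\<Sum>m<d. of_bool (m = 0))"
    using nat_dvd_not_less by (intro sum.cong) auto
  also have "\<dots> = 1"
    using assms by (subst sum.remove[of _ 0]) auto
  finally show ?thesis
    using sum_periods[of "\<lambda>m. of_bool (d dvd m)" d k] by (simp add: dvd_mod_iff)
qed

text \<open>Full periods contribute at most \<open>0\<close>, and the incomplete last one fewer than \<open>A\<close> terms.\<close>

lemma sum_periodic_le:
  fixes g :: "nat \<Rightarrow> real"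
  assumes per: "\<And>m. g (m mod A) = g m" and "A > 0"
    and le: "(\<Sum>m<A. g m) \<le> 0" and g: "\<And>m. g m \<le> 1"
  shows "(\<Sum>m<M. g m) \<le> real A"
proof -
  have "(\<Sum>m<M. g m) = (\<Sum>m<M div A * A. g m) + (\<Sum>m = M div A * A..<M. g m)"
    using sum.atLeastLessThan_concat[of 0 "M div A * A" M g] by (simp add: atLeast0LessThan)
  also have "\<dots> \<le> 0 + real A"
  proof (rule add_mono)
    show "(\<Sum>m<M div A * A. g m) \<le> 0"
      using le by (simp add: sum_periods[of g A, OF per] mult_nonneg_nonpos)
    have "(\<Sum>m = M div A * A..<M. g m) \<le> (\<Sum>m = M div A * A..<M. 1)"
      by (intro sum_mono g)
    also have "\<dots> = real (M mod A)"
      by (simp add: minus_div_mult_eq_mod)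
    also have "\<dots> \<le> real A"
      using \<open>A > 0\<close> by (simp add: less_imp_le)
    finally show "(\<Sum>m = M div A * A..<M. g m) \<le> real A" .
  qed
  finally show ?thesis by simp
qed

text \<open>Partial summation: a non-negative, non-increasing weight on a sequence with partial sums bounded above by \<open>K\<close>
  gives a sum bounded by \<open>K\<close> times the first weight. The partial sums may be arbitrarily negative.\<close>

lemma abel_bound:
  fixes u g :: "nat \<Rightarrow> real"
  assumes mono: "\<And>m. m \<ge> 1 \<Longrightarrow> u (Suc m) \<le> u m" and nonneg: "\<And>m. m \<ge> 1 \<Longrightarrow> 0 \<le> u m"
    and G: "\<And>M. (\<Sum>m = 1..M. g m) \<le> K"
  shows "(\<Sum>m = 1..M. u m * g m) \<le> K * u 1"
proof -
  have K: "0 \<le> K" using G[of 0] by simp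
  have *: "(\<Sum>m = 1..Suc M. u m * g m) \<le> K * (u 1 - u (Suc M)) + u (Suc M) * (\<Sum>m = 1..Suc M. g m)" for M
  proof (induction M)
    case (Suc M)
    have "(\<Sum>m = 1..Suc (Suc M). u m * g m)
        \<le> K * (u 1 - u (Suc M)) + u (Suc M) * (\<Sum>m = 1..Suc M. g m) + u (Suc (Suc M)) * g (Suc (Suc M))"
      using Suc by simp
    also have "\<dots> = K * (u 1 - u (Suc M)) + (u (Suc M) - u (Suc (Suc M))) * (\<Sum>m = 1..Suc M. g m)
        + u (Suc (Suc M)) * (\<Sum>m = 1..Suc (Suc M). g m)"
      by (simp add: algebra_simps)
    also have "\<dots> \<le> K * (u 1 - u (Suc M)) + (u (Suc M) - u (Suc (Suc M))) * K
        + u (Suc (Suc M)) * (\<Sum>m = 1..Suc (Suc M). g m)"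
      using mono[of "Suc M"] nonneg[of "Suc (Suc M)"] K by (intro add_mono mult_left_mono G) auto
    also have "\<dots> = K * (u 1 - u (Suc (Suc M))) + u (Suc (Suc M)) * (\<Sum>m = 1..Suc (Suc M). g m)"
      by (simp add: algebra_simps)
    finally show ?case .
  qed simp
  show ?thesis
  proof (cases M)
    case 0
    then show ?thesis using K nonneg[of 1] by simp
  next
    case (Suc n)
    have "u M * (\<Sum>m = 1..M. g m) \<le> u M * K"
      using nonneg[of M] Suc by (intro mult_left_mono G) auto
    with *[of n] Suc show ?thesis by (simp add: algebra_simps)
  qed
qed

section \<open>Divergence of the sum of the reciprocals of the primes\<close>

text \<open>The primes in increasing order, indexed from \<open>0\<close>.\<close>

abbreviation nth_prime :: "nat \<Rightarrow> nat"
  where "nth_prime \<equiv> enumerate {p. prime p}"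

lemma prime_nth_prime: "prime (nth_prime n)"
  using enumerate_in_set[OF primes_infinite] by simp

lemma nth_prime_less: "m < n \<Longrightarrow> nth_prime m < nth_prime n"
  by (rule enumerate_mono[OF _ primes_infinite])

text \<open>If the reciprocals converged, a tail (from index \<open>k\<close> on) would have sum at most \<open>1 / 2\<close>. Let
  \<open>h N\<close> be the sum of \<open>1 / n\<close> over the \<open>n \<le> N\<close> free of the first \<open>k\<close> primes. Splitting a prime off each
  \<open>n > 1\<close> gives \<open>h N \<le> 1 + h N / 2\<close>, so \<open>h N \<le> 2\<close>; but with \<open>Q\<close> the product of the first \<open>k\<close> primes,
  all numbers \<open>1 + Q * j\<close> are counted, and their reciprocals have a divergent sum.\<close>

lemma not_summable_prime_reciprocals: "\<not> summable (\<lambda>n. 1 / real (nth_prime n))"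
proof
  let ?r = "\<lambda>n. 1 / real (nth_prime n)"
  assume sum: "summable ?r"
  then obtain k where "norm (\<Sum>i. ?r (i + k)) < 1 / 2"
    using suminf_exist_split[of "1 / 2" ?r] by fastforce
  then have tail: "(\<Sum>n\<in>{k..N}. ?r n) \<le> 1 / 2" for N
  proof -
    have "(\<Sum>n\<in>{k..N}. ?r n) \<le> (\<Sum>n\<in>{0 + k..<Suc N + k}. ?r n)"
      by (intro sum_mono2) auto
    also have "\<dots> = (\<Sum>i<Suc N. ?r (i + k))"
      by (simp only: sum.shift_bounds_nat_ivl atLeast0LessThan)
    also have "\<dots> \<le> (\<Sum>i. ?r (i + k))"
      by (intro sum_le_suminf summable_ignore_initial_segment sum) auto
    finally show ?thesis
      using \<open>norm _ < _\<close> by simp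
  qed
  define D where "D N = {n \<in> {1..N}. \<forall>i<k. \<not> nth_prime i dvd n}" for N
  define h where "h N = (\<Sum>n\<in>D N. 1 / real n)" for N
  have fin: "finite (D N)" for N
    by (simp add: D_def)
  have h_le: "h N \<le> 2" for N
  proof -
    let ?m = "\<lambda>(i, n). nth_prime i * n"
    let ?X = "{k..N} \<times> D N"
    have "D N \<subseteq> insert 1 (?m ` ?X)"
    proof
      fix n assume n: "n \<in> D N"
      show "n \<in> insert 1 (?m ` ?X)"
      proof (cases "n = 1")
        case False
        then obtain p where p: "prime p" "p dvd n"
          using prime_factor_nat by blast
        then obtain i where i: "p = nth_prime i"
          using enumerate_Ex[of "{p. prime p}" p] primes_infinite by auto
        from p obtain l where l: "n = p * l" by blast
        have "n > 0" "n \<le> N" using n by (auto simp: D_def)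
        have "k \<le> i"
          using n p i by (auto simp: D_def not_less[symmetric])
        have "i \<le> p"
          using le_enumerate[OF primes_infinite] i by simp
        also have "p \<le> n" using p \<open>n > 0\<close> by (simp add: dvd_imp_le)
        finally have "i \<le> N" using \<open>n \<le> N\<close> by simp
        have "l dvd n" using l by simp
        then have "l \<in> D N"
          using n \<open>n > 0\<close> \<open>n \<le> N\<close> dvd_imp_le[of l n] unfolding D_def
          by (auto simp: Suc_le_eq dest: dvd_trans dvd_pos_nat)
        with \<open>k \<le> i\<close> \<open>i \<le> N\<close> l i show ?thesis by force
      qed simp
    qed
    then have "h N \<le> (\<Sum>n\<in>insert 1 (?m ` ?X). 1 / real n)"
      unfolding h_def using fin by (intro sum_mono2) auto
    also have "\<dots> \<le> 1 + (\<Sum>n\<in>?m ` ?X. 1 / real n)"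
      using fin by (subst sum.insert_if) auto
    also have "(\<Sum>n\<in>?m ` ?X. 1 / real n) \<le> sum ((\<lambda>n. 1 / real n) \<circ> ?m) ?X"
      using fin by (intro sum_image_le) auto
    also have "\<dots> = (\<Sum>i\<in>{k..N}. ?r i) * h N"
      by (simp add: h_def sum_product sum.cartesian_product case_prod_unfold)
    also have "\<dots> \<le> 1 / 2 * h N"
      by (intro mult_right_mono tail) (auto simp: h_def intro: sum_nonneg)
    finally show ?thesis by simp
  qed
  define Q where "Q = (\<Prod>i<k. nth_prime i)"
  have Q: "Q \<ge> 1"
    using prime_gt_0_nat[OF prime_nth_prime] by (auto simp: Q_def Suc_le_eq intro: prod_pos)
  have "(\<Sum>j<J. 1 / real (Suc j)) \<le> real Q * 2" for J
  proof -
    have "(\<Sum>j<J. 1 / real (Suc j)) \<le> (\<Sum>j<J. real Q * (1 / real (1 + Q * j)))"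
    proof (intro sum_mono)
      fix j
      have "real (1 + Q * j) \<le> real Q * real (Suc j)"
        unfolding of_nat_mult[symmetric] using Q by (intro of_nat_mono) (simp add: algebra_simps)
      then show "1 / real (Suc j) \<le> real Q * (1 / real (1 + Q * j))"
        by (simp add: divide_simps del: of_nat_Suc of_nat_add)
    qed
    also have "\<dots> = real Q * (\<Sum>j<J. 1 / real (1 + Q * j))"
      by (simp add: sum_distrib_left)
    also have "(\<Sum>j<J. 1 / real (1 + Q * j)) = (\<Sum>n\<in>(\<lambda>j. 1 + Q * j) ` {..<J}. 1 / real n)"
      using Q by (subst sum.reindex) (auto intro!: inj_onI)
    also have "\<dots> \<le> h (1 + Q * J)"
      unfolding h_def
    proof (intro sum_mono2 fin)
      show "(\<lambda>j. 1 + Q * j) ` {..<J} \<subseteq> D (1 + Q * J)"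
      proof
        fix n assume "n \<in> (\<lambda>j. 1 + Q * j) ` {..<J}"
        then obtain j where j: "j < J" "n = 1 + Q * j" by auto
        have "\<not> nth_prime i dvd n" if "i < k" for i
        proof
          assume "nth_prime i dvd n"
          moreover have "nth_prime i dvd Q * j"
            unfolding Q_def using that by (intro dvd_mult2 dvd_prodI) auto
          ultimately have "nth_prime i dvd 1"
            using j by (metis dvd_add_left_iff)
          then show False using prime_nth_prime[of i] by simp
        qed
        then show "n \<in> D (1 + Q * J)"
          using j Q by (auto simp: D_def)
      qed
    qed auto
    also have "\<dots> \<le> 2" by (rule h_le)
    finally show ?thesis using Q by simp
  qed
  then have "summable (\<lambda>j. 1 / real (Suc j))"
    by (intro summableI_nonneg_bounded) auto
  then show False
    using not_summable_harmonic[where 'a = real] summable_Suc_iff[of "\<lambda>n. inverse (real n)"]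
    by (simp add: inverse_eq_divide)
qed

text \<open>For the pairs \<open>b n < a n\<close> of consecutive primes, each prime occurring in exactly one pair, the
  subtracted terms have a divergent sum: they are comparable to \<open>1 / a n\<close> unless \<open>a n > 2 * b n\<close>,
  and pairs of the latter kind contribute a bounded amount to the sum of the \<open>1 / a n\<close>.\<close>

lemma prime_pairs_product_small:
  fixes e :: real assumes "e > 0"
  defines "a \<equiv> \<lambda>n. real (nth_prime (2 * n + 1))" and "b \<equiv> \<lambda>n. real (nth_prime (2 * n))"
  shows "\<exists>L. (\<Prod>n<L. 1 - b n / (a n * (a n + b n - 1))) \<le> e"
proof -
  let ?d = "\<lambda>n. b n / (a n * (a n + b n - 1))"
  have b: "b n \<ge> 2" for n
    unfolding b_def using prime_ge_2_nat[OF prime_nth_prime] by (simp add: numeral_le_real_of_nat_iff)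
  have ba: "b n < a n" and ab: "a n < b (Suc n)" for n
    unfolding a_def b_def by (simp_all add: nth_prime_less)
  have d_pos: "0 \<le> ?d n" for n
    using b[of n] ba[of n] by simp
  \<comment> \<open>If \<open>a n \<le> 2 * b n\<close>, the first summand suffices; otherwise the second does, and it
    contributes at most \<open>1 / b 0\<close> in total because \<open>a n < b (Suc n)\<close>.\<close>
  have step: "1 / a n \<le> 3 * ?d n + (1 / b n - 1 / a n)" for n
  proof (cases "a n \<le> 2 * b n")
    case True
    have "1 / a n \<le> 3 * ?d n"
      using True b[of n] ba[of n] by (simp add: divide_simps)
    moreover have "1 / a n \<le> 1 / b n"
      using b[of n] ba[of n] by (simp add: frac_le)
    ultimately show ?thesis by simp
  next
    case False
    then have "2 / a n \<le> 1 / b n"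
      using b[of n] ba[of n] by (simp add: field_simps)
    then show ?thesis using d_pos[of n] by simp
  qed
  have sum_le: "(\<Sum>n<L. 1 / a n) \<le> 3 * (\<Sum>n<L. ?d n) + 1 / b 0" for L
  proof -
    have "(\<Sum>n<L. 1 / a n) \<le> 3 * (\<Sum>n<L. ?d n) + 1 / b 0 - 1 / b L"
    proof (induction L)
      case (Suc L)
      have "1 / b (Suc L) \<le> 1 / a L"
        using ab[of L] ba[of L] b[of L] by (simp add: frac_le)
      with Suc step[of L] show ?case by (simp add: algebra_simps)
    qed simp
    also have "\<dots> \<le> 3 * (\<Sum>n<L. ?d n) + 1 / b 0"
      using b[of L] by simp
    finally show ?thesis .
  qed
  have "\<not> summable ?d"
  proof
    assume "summable ?d"
    have bound: "(\<Sum>n<L. 1 / a n) \<le> 3 * suminf ?d + 1 / b 0" for L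
      using sum_le[of L] sum_le_suminf[OF \<open>summable ?d\<close>, of "{..<L}"] d_pos by fastforce
    then have sa: "summable (\<lambda>n. 1 / a n)"
      by (intro summableI_nonneg_bounded) (auto simp: a_def)
    have "(\<Sum>n<M. 1 / real (nth_prime n)) \<le> 1 / b 0 + 2 * suminf (\<lambda>n. 1 / a n)" for M
    proof -
      have *: "(\<Sum>n<2 * L + 1. 1 / real (nth_prime n)) \<le> 1 / b 0 + 2 * (\<Sum>n<L. 1 / a n)" for L
      proof (induction L)
        case 0
        then show ?case by (simp add: b_def)
      next
        case (Suc L)
        have "1 / b (Suc L) \<le> 1 / a L"
          using ab[of L] ba[of L] b[of L] by (simp add: frac_le)
        moreover have "1 / real (nth_prime (2 * L + 1)) = 1 / a L"
          "1 / real (nth_prime (2 * L + 2)) = 1 / b (Suc L)"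
          by (simp_all add: a_def b_def)
        ultimately show ?case using Suc by simp
      qed
      have "(\<Sum>n<M. 1 / real (nth_prime n)) \<le> (\<Sum>n<2 * M + 1. 1 / real (nth_prime n))"
        by (intro sum_mono2) auto
      also have "\<dots> \<le> 1 / b 0 + 2 * (\<Sum>n<M. 1 / a n)" by (rule *)
      also have "\<dots> \<le> 1 / b 0 + 2 * suminf (\<lambda>n. 1 / a n)"
        using sum_le_suminf[OF sa, of "{..<M}"] by (simp add: a_def)
      finally show ?thesis .
    qed
    then have "summable (\<lambda>n. 1 / real (nth_prime n))"
      by (intro summableI_nonneg_bounded) auto
    then show False by (simp add: not_summable_prime_reciprocals)
  qed
  then have "\<exists>L. (\<Sum>n<L. ?d n) > - ln e"
    using summableI_nonneg_bounded[of ?d "- ln e"] d_pos by (meson not_le)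
  then obtain L where L: "(\<Sum>n<L. ?d n) > - ln e" by blast
  have "(\<Prod>n<L. 1 - ?d n) \<le> (\<Prod>n<L. exp (- ?d n))"
  proof (intro prod_mono conjI)
    fix n
    have "b n * 1 \<le> a n * (a n + b n - 1)"
      using b[of n] ba[of n] by (intro mult_mono) auto
    then show "0 \<le> 1 - ?d n"
      using b[of n] ba[of n] by (simp add: field_simps)
    show "1 - ?d n \<le> exp (- ?d n)"
      using exp_ge_add_one_self[of "- ?d n"] by simp
  qed
  also have "\<dots> = exp (- (\<Sum>n<L. ?d n))"
    by (simp add: exp_sum flip: sum_negf)
  also have "\<dots> \<le> exp (ln e)"
    using L by (subst exp_le_cancel_iff) simp
  also have "\<dots> = e" using assms(1) by simp
  finally show ?thesis by blast
qed

section \<open>Integers divisible by a member of each pair\<close>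

lemma of_bool_ball_eq_prod:
  "finite I \<Longrightarrow> of_bool (\<forall>i\<in>I. P i) = (\<Prod>i\<in>I. of_bool (P i) :: real)"
  by (induction I rule: finite_induct) auto

lemma prod_dvd_of_pairwise_coprime:
  fixes d :: "'i \<Rightarrow> nat"
  assumes "finite I" and "\<And>i. i \<in> I \<Longrightarrow> d i dvd m"
    and "\<And>i j. i \<in> I \<Longrightarrow> j \<in> I \<Longrightarrow> i \<noteq> j \<Longrightarrow> coprime (d i) (d j)"
  shows "(\<Prod>i\<in>I. d i) dvd m"
  using assms
proof (induction I rule: finite_induct)
  case (insert x I)
  have "coprime (d x) (\<Prod>i\<in>I. d i)"
    using insert.prems(2) insert.hyps(2) by (intro prod_coprime_right) auto
  with insert show ?case by (simp add: divides_mult)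
qed simp

text \<open>Finitely many pairs \<open>b j < a j\<close> of positive integers whose \<open>2 * card J\<close> members are pairwise
  coprime. The arguments in this locale do not need them to be prime.\<close>

locale coprime_pairs =
  fixes J :: "'i set" and a b :: "'i \<Rightarrow> nat"
  assumes finite_J: "finite J"
    and b_pos: "j \<in> J \<Longrightarrow> 0 < b j"
    and b_less_a: "j \<in> J \<Longrightarrow> b j < a j"
    and coprime_ab: "j \<in> J \<Longrightarrow> coprime (a j) (b j)"
    and coprime_cross: "i \<in> J \<Longrightarrow> j \<in> J \<Longrightarrow> i \<noteq> j \<Longrightarrow> coprime (a i * b i) (a j * b j)"
begin

lemma a_pos: "j \<in> J \<Longrightarrow> 0 < a j"
  using b_less_a by fastforce

text \<open>An admissible number is divisible by at least one member of each pair.\<close>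

definition admissible :: "nat \<Rightarrow> bool"
  where "admissible m \<longleftrightarrow> (\<forall>j\<in>J. a j dvd m \<or> b j dvd m)"

text \<open>A common period of all the divisibility conditions.\<close>

definition period :: nat
  where "period = (\<Prod>j\<in>J. a j * b j)"

text \<open>The proportion of integers that are divisible by none of those \<open>a j\<close> which divide \<open>m\<close>.\<close>

definition new_density :: "nat \<Rightarrow> real"
  where "new_density m = (\<Prod>j\<in>J. if a j dvd m then 1 - 1 / a j else 1)"

text \<open>The numerators \<open>c\<close> for which \<open>c / q\<close>, with \<open>q\<close> a multiple of \<open>m\<close>, cannot be rewritten with a smaller
  denominator by exchanging in \<open>c\<close> and \<open>m\<close> a common factor \<open>a j\<close> for \<open>b j\<close>. Both endpoints \<open>0\<close> and \<open>q\<close> are allowed, since \<open>\<alpha>\<close> ranges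
  over the closed unit interval.\<close>

definition new_numerators :: "nat \<Rightarrow> nat \<Rightarrow> nat set"
  where "new_numerators q m = {c \<in> {..q}. \<forall>j\<in>J. a j dvd m \<longrightarrow> \<not> a j dvd c}"

lemma period_pos: "period > 0"
  unfolding period_def using a_pos b_pos by (intro prod_pos) auto

lemma pair_dvd_period:
  assumes "j \<in> J" shows "a j dvd period" "b j dvd period"
proof -
  have "a j * b j dvd period"
    unfolding period_def by (rule dvd_prodI[OF finite_J assms])
  then show "a j dvd period" "b j dvd period"
    by (rule dvd_mult_left, rule dvd_mult_right)
qed

lemma admissible_mod_period: "admissible (m mod period) \<longleftrightarrow> admissible m"
  unfolding admissible_def by (intro ball_cong refl) (simp add: dvd_mod_iff pair_dvd_period)

lemma new_density_mod_period: "new_density (m mod period) = new_density m"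
  unfolding new_density_def by (intro prod.cong refl) (simp add: dvd_mod_iff pair_dvd_period(1))

lemma admissible_multiple: "period dvd m \<Longrightarrow> admissible m"
  unfolding admissible_def using pair_dvd_period(1) by (meson dvd_trans)

lemma new_density_nonneg: "0 \<le> new_density m"
  unfolding new_density_def using a_pos by (intro prod_nonneg) (auto simp: Suc_le_eq)

lemma new_density_le_1: "new_density m \<le> 1"
  unfolding new_density_def using a_pos by (intro prod_le_1) (auto simp: Suc_le_eq)

lemma sum_admissible_one_pair:
  fixes A B :: nat and w :: real
  assumes "A > 0" "B > 0" "coprime A B"
  shows "(\<Sum>m<A * B. of_bool (A dvd m \<or> B dvd m) * (if A dvd m then 1 - w else 1))
       = real A + real B - 1 - w * real B"
proof -
  have "(\<Sum>m<A * B. of_bool (A dvd m \<or> B dvd m) * (if A dvd m then 1 - w else 1))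
      = (\<Sum>m<A * B. (1 - w) * of_bool (A dvd m) + of_bool (B dvd m) - of_bool (A * B dvd m))"
  proof (intro sum.cong refl)
    fix m
    have "A * B dvd m \<longleftrightarrow> A dvd m \<and> B dvd m"
      using \<open>coprime A B\<close> by (meson divides_mult dvd_mult_left dvd_mult_right)
    then show "of_bool (A dvd m \<or> B dvd m) * (if A dvd m then 1 - w else 1)
        = (1 - w) * of_bool (A dvd m) + of_bool (B dvd m) - of_bool (A * B dvd m)"
      by auto
  qed
  also have "\<dots> = (1 - w) * B + A - 1"
    using sum_multiples_indicator[of A B] sum_multiples_indicator[of B A]
      sum_multiples_indicator[of "A * B" 1] assms
    by (simp add: sum.distrib sum_subtractf mult.commute[of A B] flip: sum_distrib_left)
  finally show ?thesis by (simp add: algebra_simps)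
qed

text \<open>The general weight \<open>w\<close> serves two purposes: \<open>w j = 1 / a j\<close> gives the sum of the densities, and \<open>w = 0\<close>
  the number of admissible residues.\<close>

lemma sum_admissible_weighted:
  fixes w :: "'i \<Rightarrow> real"
  shows "(\<Sum>m<period. of_bool (admissible m) * (\<Prod>j\<in>J. if a j dvd m then 1 - w j else 1))
       = (\<Prod>j\<in>J. real (a j) + real (b j) - 1 - w j * real (b j))"
proof -
  let ?h = "\<lambda>j m. of_bool (a j dvd m \<or> b j dvd m) * (if a j dvd m then 1 - w j else 1)"
  have "of_bool (admissible m) = (\<Prod>j\<in>J. of_bool (a j dvd m \<or> b j dvd m) :: real)" for m
    unfolding admissible_def by (rule of_bool_ball_eq_prod[OF finite_J])
  then have "(\<Sum>m<period. of_bool (admissible m) * (\<Prod>j\<in>J. if a j dvd m then 1 - w j else 1))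
      = (\<Sum>m<(\<Prod>j\<in>J. a j * b j). \<Prod>j\<in>J. ?h j m)"
    by (simp add: period_def prod.distrib)
  also have "\<dots> = (\<Prod>j\<in>J. \<Sum>m<a j * b j. ?h j m)"
    using finite_J a_pos b_pos coprime_cross
    by (intro sum_prod_periodic) (auto simp: dvd_mod_iff)
  also have "\<dots> = (\<Prod>j\<in>J. real (a j) + real (b j) - 1 - w j * real (b j))"
    using a_pos b_pos coprime_ab by (intro prod.cong refl sum_admissible_one_pair)
  finally show ?thesis .
qed

text \<open>The mean of \<open>new_density\<close> over the admissible residues is an explicit product.\<close>

lemma sum_new_density_period:
  "(\<Sum>m<period. of_bool (admissible m) * new_density m)
     = (\<Prod>j\<in>J. 1 - b j / (a j * (real (a j) + b j - 1))) * (\<Sum>m<period. of_bool (admissible m))"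
proof -
  have "(\<Sum>m<period. of_bool (admissible m) * new_density m)
      = (\<Prod>j\<in>J. real (a j) + b j - 1 - 1 / a j * b j)"
    unfolding new_density_def by (rule sum_admissible_weighted)
  also have "\<dots> = (\<Prod>j\<in>J. (1 - b j / (a j * (real (a j) + b j - 1))) * (real (a j) + b j - 1 - 0 * b j))"
  proof (intro prod.cong refl)
    fix j assume "j \<in> J"
    define s where "s = real (a j) + real (b j) - 1"
    have "s > 0" "real (a j) > 0"
      using a_pos[of j] b_pos[of j] \<open>j \<in> J\<close> by (simp_all add: s_def)
    then have "s - 1 / a j * b j = (1 - b j / (a j * s)) * (s - 0 * b j)"
      by (simp add: field_simps)
    then show "real (a j) + b j - 1 - 1 / a j * b j
        = (1 - b j / (a j * (real (a j) + b j - 1))) * (real (a j) + b j - 1 - 0 * b j)"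
      by (simp only: s_def)
  qed
  also have "\<dots> = (\<Prod>j\<in>J. 1 - b j / (a j * (real (a j) + b j - 1)))
      * (\<Sum>m<period. of_bool (admissible m))"
    using sum_admissible_weighted[of "\<lambda>_. 0"] by (simp add: prod.distrib cong: if_cong)
  finally show ?thesis .
qed

lemma card_new_numerators:
  assumes "m > 0" "m dvd q" "q > 0"
  shows "real (card (new_numerators q m)) \<le> 2 * real q * new_density m"
proof -
  define G where "G = {j \<in> J. a j dvd m}"
  have G: "finite G" "G \<subseteq> J" using finite_J by (auto simp: G_def)
  let ?h = "\<lambda>j c. of_bool (\<not> a j dvd c) :: real"
  let ?new = "\<lambda>c. \<forall>j\<in>G. \<not> a j dvd c"
  define R where "R = (\<Prod>j\<in>G. a j)"
  have cop: "coprime (a i) (a j)" if "i \<in> G" "j \<in> G" "i \<noteq> j" for i j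
    using coprime_cross[of i j] that G by auto
  have R_pos: "R > 0"
    unfolding R_def using G a_pos by (intro prod_pos) auto
  have "R dvd m"
    unfolding R_def using G(1) cop by (intro prod_dvd_of_pairwise_coprime) (auto simp: G_def)
  with \<open>m dvd q\<close> obtain k where k: "q = k * R"
    by (metis dvd_div_mult_self dvd_trans)
  have ind: "of_bool (?new c) = (\<Prod>j\<in>G. ?h j c)" for c
    by (rule of_bool_ball_eq_prod[OF G(1)])
  have one: "(\<Sum>c<a j. ?h j c) = a j * (1 - 1 / a j)" if "j \<in> G" for j
  proof -
    have "a j > 0" using that G a_pos by auto
    have "(\<Sum>c<a j. ?h j c) = (\<Sum>c<a j. 1 - of_bool (a j dvd c))"
      by (intro sum.cong) auto
    also have "\<dots> = real (a j) - 1"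
      using sum_multiples_indicator[of "a j" 1] \<open>a j > 0\<close> by (simp add: sum_subtractf del: sum_of_bool_eq)
    also have "\<dots> = a j * (1 - 1 / a j)"
      using \<open>a j > 0\<close> by (simp add: field_simps)
    finally show ?thesis .
  qed
  have "real (card {c \<in> {..<q}. ?new c}) = (\<Sum>c<k * R. of_bool (?new c))"
    by (simp add: k of_bool_def sum.If_cases Int_def)
  also have "\<dots> = real k * (\<Sum>c<R. of_bool (?new c))"
    unfolding ind using G by (intro sum_periods) (auto simp: R_def dvd_mod_iff intro!: prod_periodic)
  also have "(\<Sum>c<R. of_bool (?new c)) = (\<Prod>j\<in>G. \<Sum>c<a j. ?h j c)"
    unfolding R_def ind using G a_pos cop by (intro sum_prod_periodic) (auto simp: dvd_mod_iff)
  also have "\<dots> = (\<Prod>j\<in>G. a j * (1 - 1 / a j))"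
    by (intro prod.cong refl one)
  also have "\<dots> = R * (\<Prod>j\<in>G. 1 - 1 / a j)"
    by (simp add: prod.distrib R_def)
  also have "(\<Prod>j\<in>G. 1 - 1 / a j) = new_density m"
    unfolding new_density_def G_def using finite_J by (simp add: prod.inter_filter)
  finally have card_lt: "real (card {c \<in> {..<q}. ?new c}) = real q * new_density m"
    by (simp add: k)
  \<comment> \<open>The numerators \<open>0\<close> and \<open>q\<close> are new simultaneously, whence the factor 2.\<close>
  have "?new q \<longleftrightarrow> ?new 0"
    using \<open>m dvd q\<close> dvd_trans[of _ m q] by (auto simp: G_def)
  then have "new_numerators q m \<subseteq> {c \<in> {..<q}. ?new c} \<union> (if ?new 0 then {q} else {})"
    unfolding new_numerators_def G_def by (auto simp: le_less)
  then have "card (new_numerators q m) \<le> card ({c \<in> {..<q}. ?new c} \<union> (if ?new 0 then {q} else {}))"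
    by (intro card_mono) auto
  also have "\<dots> \<le> card {c \<in> {..<q}. ?new c} + card (if ?new 0 then {q} else {})"
    by (rule card_Un_le)
  also have "card (if ?new 0 then {q} else {}) \<le> card {c \<in> {..<q}. ?new c}"
  proof (cases "?new 0")
    case True
    then have "0 \<in> {c \<in> {..<q}. ?new c}" using \<open>q > 0\<close> by simp
    then have "card {c \<in> {..<q}. ?new c} > 0" by (subst card_gt_0_iff) auto
    with True show ?thesis using \<open>q > 0\<close> by simp
  qed simp
  finally show ?thesis using card_lt by simp
qed

lemma admissible_exchange:
  assumes "admissible m" "j \<in> J" "a j dvd m"
  shows "admissible (m div a j * b j)"
  unfolding admissible_def
proof
  fix i assume i: "i \<in> J"
  obtain l where l: "m = a j * l" using assms by blast
  have "m div a j = l" using l a_pos[OF \<open>j \<in> J\<close>] by simp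
  show "a i dvd m div a j * b j \<or> b i dvd m div a j * b j"
  proof (cases "i = j")
    case False
    then have "coprime (a i) (a j)" "coprime (b i) (a j)"
      using coprime_cross[OF i \<open>j \<in> J\<close>] by auto
    moreover have "a i dvd a j * l \<or> b i dvd a j * l"
      using assms(1) i l by (auto simp: admissible_def)
    ultimately have "a i dvd l \<or> b i dvd l"
      by (auto simp: coprime_dvd_mult_right_iff)
    with \<open>m div a j = l\<close> show ?thesis by auto
  qed simp
qed

end

section \<open>The measure of one block\<close>

lemma int_dist_nonneg: "0 \<le> int_dist x"
  unfolding int_dist_def by (intro cINF_greatest) auto

lemma int_dist_less_imp_fraction:
  assumes "\<alpha> \<in> {0..1}" "q > 0" "int_dist (of_nat q * \<alpha>) < r" "r \<le> 1"
  shows "\<exists>c\<le>q. \<bar>\<alpha> - real c / real q\<bar> < r / real q"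
proof -
  obtain z :: int where z: "int_dist (of_nat q * \<alpha>) = \<bar>of_nat q * \<alpha> - of_int z\<bar>"
    using int_dist_is_minimum by blast
  have d: "\<bar>real q * \<alpha> - of_int z\<bar> < r" using assms(3) z by simp
  have "0 \<le> real q * \<alpha>" "real q * \<alpha> \<le> real q"
    using assms by (auto simp: mult_left_le)
  with d \<open>r \<le> 1\<close> have "-1 < real_of_int z" "real_of_int z < real q + 1" by linarith+
  then have "0 \<le> z" "z \<le> int q" by linarith+
  then obtain c where c: "z = int c" "c \<le> q"
    by (metis nat_0_le nat_le_iff)
  have "\<alpha> - real c / real q = (real q * \<alpha> - of_int z) / real q"
    using \<open>q > 0\<close> c by (simp add: field_simps)
  then have "\<bar>\<alpha> - real c / real q\<bar> = \<bar>real q * \<alpha> - of_int z\<bar> / real q"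
    by (simp add: abs_divide)
  also have "\<dots> < r / real q"
    using d \<open>q > 0\<close> by (simp add: divide_strict_right_mono)
  finally show ?thesis using c by blast
qed

context coprime_pairs
begin

text \<open>Every \<open>\<alpha>\<close> approximated by the block lies in an interval around a fraction with a new numerator,
  namely one for the least \<open>m\<close> that serves \<open>\<alpha>\<close>. The hypothesis \<open>f N \<le> 1\<close> confines the numerators
  to \<open>{0..N * m}\<close>.\<close>

lemma hits_subset_new_intervals:
  fixes f :: "nat \<Rightarrow> real"
  assumes "N > 0" and mono: "\<And>p q. 1 \<le> p \<Longrightarrow> p \<le> q \<Longrightarrow> f q \<le> f p"
    and nonneg: "\<And>q. 1 \<le> q \<Longrightarrow> 0 \<le> f q" and "f N \<le> 1"
    and \<alpha>: "\<alpha> \<in> {0..1}" and n: "n \<in> {1..B}" "admissible n"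
    and hit: "int_dist (of_nat (N * n) * \<alpha>) < f (N * n)"
  shows "\<exists>m\<in>{1..B}. admissible m \<and> (\<exists>c\<in>new_numerators (N * m) m.
           \<bar>\<alpha> - real c / real (N * m)\<bar> < f (N * m) / real (N * m))"
proof -
  define P where "P m \<longleftrightarrow> m \<in> {1..B} \<and> admissible m \<and>
    (\<exists>c\<le>N * m. \<bar>\<alpha> - real c / real (N * m)\<bar> < f (N * m) / real (N * m))" for m
  have "f (N * n) \<le> f N" using n \<open>N > 0\<close> by (intro mono) auto
  then have "P n"
    unfolding P_def using int_dist_less_imp_fraction[OF \<alpha> _ hit] n \<open>N > 0\<close> \<open>f N \<le> 1\<close> by auto
  then obtain m where m: "P m" and least: "\<And>k. k < m \<Longrightarrow> \<not> P k"
    using exists_least_iff[of P] by blast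
  then obtain c where c: "c \<le> N * m"
    "\<bar>\<alpha> - real c / real (N * m)\<bar> < f (N * m) / real (N * m)" by (auto simp: P_def)
  have mB: "m \<in> {1..B}" "admissible m" using m by (auto simp: P_def)
  \<comment> \<open>If \<open>a j\<close> divided both \<open>m\<close> and \<open>c\<close>, then replacing the factor \<open>a j\<close> by \<open>b j\<close> in both
    would preserve the fraction and decrease \<open>m\<close>, while the interval would only grow.\<close>
  have "\<not> a j dvd c" if j: "j \<in> J" "a j dvd m" for j
  proof
    assume "a j dvd c"
    then obtain c' where c': "c = a j * c'" by blast
    obtain l where l: "m = a j * l" using j by blast
    have pos: "a j > 0" "b j > 0" "b j < a j" using a_pos b_pos b_less_a j by auto
    have "l > 0" using mB l by (cases l) auto
    let ?k = "l * b j"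
    have m_div: "m div a j = l" using l pos by simp
    have adm: "admissible ?k" using admissible_exchange[OF mB(2) j] unfolding m_div .
    have less: "?k < m" using l pos \<open>l > 0\<close> by simp
    have k1: "?k \<ge> 1" using pos \<open>l > 0\<close> by (simp add: Suc_le_eq)
    have eq: "real (c' * b j) / real (N * ?k) = real c / real (N * m)"
      using c' l pos by simp
    have "N * m = a j * (N * l)" unfolding l by (rule mult.left_commute)
    then have "a j * c' \<le> a j * (N * l)" using c(1) unfolding c' by (rule subst)
    then have "c' \<le> N * l" using pos(1) by (rule nat_mult_le_cancel1[THEN iffD1, rotated])
    then have numerator_le: "c' * b j \<le> N * ?k"
      unfolding mult.assoc[symmetric] by (rule mult_le_mono1)
    have radius_le: "f (N * m) / real (N * m) \<le> f (N * ?k) / real (N * ?k)"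
    proof (rule frac_le)
      show "f (N * m) \<le> f (N * ?k)" using \<open>N > 0\<close> k1 less by (intro mono) auto
      show "0 \<le> f (N * ?k)" using \<open>N > 0\<close> k1 by (intro nonneg) auto
      show "0 < real (N * ?k)" using \<open>N > 0\<close> k1 by simp
      show "real (N * ?k) \<le> real (N * m)" using less by (intro of_nat_mono mult_le_mono) auto
    qed
    have "?k \<in> {1..B}" using mB(1) less k1 by simp
    moreover have "\<bar>\<alpha> - real (c' * b j) / real (N * ?k)\<bar> < f (N * ?k) / real (N * ?k)"
      unfolding eq using c(2) radius_le by (rule less_le_trans)
    ultimately have "P ?k"
      unfolding P_def using adm numerator_le by blast
    then show False using least less by blast
  qed
  with c mB show ?thesis
    unfolding new_numerators_def by blast
qed

lemma hits_measure_le: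
  fixes f :: "nat \<Rightarrow> real"
  assumes "N > 0" and mono: "\<And>p q. 1 \<le> p \<Longrightarrow> p \<le> q \<Longrightarrow> f q \<le> f p"
    and nonneg: "\<And>q. 1 \<le> q \<Longrightarrow> 0 \<le> f q" and "f N \<le> 1"
  shows "\<exists>V\<in>sets lborel.
    {\<alpha> \<in> {0..1}. \<exists>n\<in>{1..B}. admissible n \<and> int_dist (of_nat (N * n) * \<alpha>) < f (N * n)} \<subseteq> V \<and>
    emeasure lborel V \<le> ennreal (4 * (\<Sum>m = 1..B. f (N * m) * (of_bool (admissible m) * new_density m)))"
proof -
  define I where "I = {m \<in> {1..B}. admissible m}"
  define iv where "iv m c = {real c / real (N * m) - f (N * m) / real (N * m) <..<
    real c / real (N * m) + f (N * m) / real (N * m)}" for m c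
  define W where "W m = (\<Union>c\<in>new_numerators (N * m) m. iv m c)" for m
  have fin: "finite I" "finite (new_numerators q m)" for q m
    by (simp_all add: I_def new_numerators_def)
  have W_meas: "W m \<in> sets lborel" for m
    unfolding W_def iv_def using fin by (intro sets.finite_UN) auto
  have W_le: "emeasure lborel (W m) \<le> ennreal (4 * (f (N * m) * new_density m))" if "m \<in> I" for m
  proof -
    have pos: "m > 0" "N * m > 0" using that \<open>N > 0\<close> by (auto simp: I_def)
    have f0: "0 \<le> f (N * m)" using pos by (intro nonneg) auto
    then have r0: "0 \<le> f (N * m) / real (N * m)" by simp
    have "emeasure lborel (W m) \<le> (\<Sum>c\<in>new_numerators (N * m) m. emeasure lborel (iv m c))"
      unfolding W_def using fin by (intro emeasure_subadditive_finite) (auto simp: iv_def)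
    also have "\<dots> = (\<Sum>c\<in>new_numerators (N * m) m. ennreal (2 * (f (N * m) / real (N * m))))"
    proof (rule sum.cong[OF refl])
      fix c
      show "emeasure lborel (iv m c) = ennreal (2 * (f (N * m) / real (N * m)))"
        unfolding iv_def using r0 by (subst emeasure_lborel_Ioo) (auto simp del: of_nat_mult)
    qed
    also have "\<dots> = ennreal (real (card (new_numerators (N * m) m)) * (2 * (f (N * m) / real (N * m))))"
      using r0 by (subst sum_ennreal) (auto simp del: of_nat_mult)
    also have "\<dots> \<le> ennreal (2 * real (N * m) * new_density m * (2 * (f (N * m) / real (N * m))))"
      using pos r0 by (intro ennreal_leI mult_right_mono card_new_numerators) (auto simp del: of_nat_mult)
    also have "2 * real (N * m) * new_density m * (2 * (f (N * m) / real (N * m)))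
        = 4 * (f (N * m) * new_density m)"
      using pos by (simp add: field_simps)
    finally show ?thesis .
  qed
  show ?thesis
  proof (intro bexI[of _ "\<Union>m\<in>I. W m"] conjI)
    show "(\<Union>m\<in>I. W m) \<in> sets lborel"
      using fin W_meas by (intro sets.finite_UN) auto
    have "\<alpha> \<in> (\<Union>m\<in>I. W m)" if hit: "\<alpha> \<in> {0..1}" "n \<in> {1..B}" "admissible n"
      "int_dist (of_nat (N * n) * \<alpha>) < f (N * n)" for \<alpha> n
    proof -
      have "\<exists>m\<in>{1..B}. admissible m \<and> (\<exists>c\<in>new_numerators (N * m) m.
          \<bar>\<alpha> - real c / real (N * m)\<bar> < f (N * m) / real (N * m))"
        by (rule hits_subset_new_intervals[OF assms hit])
      then obtain m c where mc: "m \<in> {1..B}" "admissible m" "c \<in> new_numerators (N * m) m"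
        "\<bar>\<alpha> - real c / real (N * m)\<bar> < f (N * m) / real (N * m)"
        by (elim bexE conjE)
      then have "\<alpha> \<in> iv m c"
        unfolding iv_def greaterThanLessThan_iff by linarith
      with mc have "\<alpha> \<in> W m" "m \<in> I" by (auto simp: W_def I_def)
      then show ?thesis by (rule UN_I[rotated])
    qed
    then show "{\<alpha> \<in> {0..1}. \<exists>n\<in>{1..B}. admissible n \<and>
        int_dist (of_nat (N * n) * \<alpha>) < f (N * n)} \<subseteq> (\<Union>m\<in>I. W m)" by blast
    have "emeasure lborel (\<Union>m\<in>I. W m) \<le> (\<Sum>m\<in>I. emeasure lborel (W m))"
      using fin W_meas by (intro emeasure_subadditive_finite) auto
    also have "\<dots> \<le> (\<Sum>m\<in>I. ennreal (4 * (f (N * m) * new_density m)))"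
      by (intro sum_mono W_le)
    also have "\<dots> = ennreal (\<Sum>m\<in>I. 4 * (f (N * m) * new_density m))"
      using nonneg \<open>N > 0\<close> new_density_nonneg
      by (intro sum_ennreal mult_nonneg_nonneg) (auto simp: I_def Suc_le_eq)
    also have "(\<Sum>m\<in>I. 4 * (f (N * m) * new_density m))
        = 4 * (\<Sum>m = 1..B. f (N * m) * (of_bool (admissible m) * new_density m))"
      unfolding I_def sum_distrib_left
      by (subst sum.inter_filter) (auto intro!: sum.cong)
    finally show "emeasure lborel (\<Union>m\<in>I. W m)
      \<le> ennreal (4 * (\<Sum>m = 1..B. f (N * m) * (of_bool (admissible m) * new_density m)))" .
  qed
qed

text \<open>Weighted by a non-increasing sequence, the densities of the admissible numbers still average to
  at most \<open>e\<close>, up to an error that does not depend on the length \<open>B\<close>.\<close>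

lemma weighted_new_density_le:
  fixes u :: "nat \<Rightarrow> real"
  assumes mono: "\<And>m. m \<ge> 1 \<Longrightarrow> u (Suc m) \<le> u m" and nonneg: "\<And>m. m \<ge> 1 \<Longrightarrow> 0 \<le> u m"
    and e: "0 \<le> e" "e \<le> 1" "(\<Prod>j\<in>J. 1 - b j / (a j * (real (a j) + b j - 1))) \<le> e"
  shows "(\<Sum>m = 1..B. u m * (of_bool (admissible m) * new_density m))
    \<le> e * (\<Sum>m = 1..B. u m * of_bool (admissible m)) + (real period + 1) * u 1"
proof -
  define g where "g m = of_bool (admissible m) * (new_density m - e)" for m
  have g_le: "g m \<le> 1" and g_ge: "-1 \<le> g m" for m
    using new_density_nonneg[of m] new_density_le_1[of m] e by (auto simp: g_def)
  have "(\<Sum>m<period. g m) = (\<Sum>m<period. of_bool (admissible m) * new_density m)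
      - e * (\<Sum>m<period. of_bool (admissible m))"
    unfolding g_def right_diff_distrib sum_subtractf sum_distrib_left by (simp only: mult.commute)
  also have "\<dots> \<le> 0"
    unfolding sum_new_density_period using mult_right_mono[OF e(3), of "\<Sum>m<period. of_bool (admissible m)"]
    by (simp add: sum_nonneg)
  finally have period_le: "(\<Sum>m<period. g m) \<le> 0" .
  have G: "(\<Sum>m = 1..M. g m) \<le> real period + 1" for M
  proof -
    have "(\<Sum>m<Suc M. g m) \<le> real period"
      by (rule sum_periodic_le[OF _ period_pos period_le g_le])
        (simp add: g_def admissible_mod_period new_density_mod_period)
    moreover have "(\<Sum>m<Suc M. g m) = g 0 + (\<Sum>m = 1..M. g m)"
      by (simp only: sum.lessThan_Suc_shift sum.atLeast1_atMost_eq One_nat_def)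
    ultimately show ?thesis using g_ge[of 0] by simp
  qed
  have "(\<Sum>m = 1..B. u m * g m) \<le> (real period + 1) * u 1"
    by (rule abel_bound[where u = u and g = g, OF mono nonneg G])
  moreover have "(\<Sum>m = 1..B. u m * g m) = (\<Sum>m = 1..B. u m * (of_bool (admissible m) * new_density m))
      - e * (\<Sum>m = 1..B. u m * of_bool (admissible m))"
    unfolding g_def sum_distrib_left sum_subtractf[symmetric] by (intro sum.cong refl) (simp add: algebra_simps)
  ultimately show ?thesis by simp
qed

end

text \<open>Since \<open>f\<close> is non-increasing, \<open>f (D * (j + 1))\<close> dominates the \<open>D\<close>-th part of the sum of \<open>f\<close> over the
  \<open>D\<close> integers from \<open>D * (j + 1)\<close> on.\<close>

lemma not_summable_multiples:
  fixes f :: "nat \<Rightarrow> real"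
  assumes mono: "\<And>p q. 1 \<le> p \<Longrightarrow> p \<le> q \<Longrightarrow> f q \<le> f p"
    and nonneg: "\<And>q. 1 \<le> q \<Longrightarrow> 0 \<le> f q" and "\<not> summable f" "D > 0"
  shows "\<not> summable (\<lambda>j. f (D * Suc j))"
proof
  assume sum: "summable (\<lambda>j. f (D * Suc j))"
  have "(\<Sum>q<J. f (q + D)) \<le> real D * (\<Sum>j. f (D * Suc j))" for J
  proof -
    have "(\<Sum>q<J. f (q + D)) \<le> (\<Sum>q<J * D. f (q + D))"
      using \<open>D > 0\<close> nonneg by (intro sum_mono2) auto
    also have "\<dots> = (\<Sum>j<J. \<Sum>q = j * D..<j * D + D. f (q + D))"
      by (rule sum.nat_group[symmetric])
    also have "\<dots> \<le> (\<Sum>j<J. real D * f (D * Suc j))"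
    proof (rule sum_mono)
      fix j
      have "(\<Sum>q = j * D..<j * D + D. f (q + D)) \<le> (\<Sum>q = j * D..<j * D + D. f (D * Suc j))"
        using \<open>D > 0\<close> by (intro sum_mono mono) (auto simp: mult.commute)
      then show "(\<Sum>q = j * D..<j * D + D. f (q + D)) \<le> real D * f (D * Suc j)"
        by simp
    qed
    also have "\<dots> = real D * (\<Sum>j<J. f (D * Suc j))"
      by (rule sum_distrib_left[symmetric])
    also have "\<dots> \<le> real D * (\<Sum>j. f (D * Suc j))"
      using \<open>D > 0\<close> nonneg by (intro mult_left_mono sum_le_suminf sum) auto
    finally show ?thesis .
  qed
  then have "summable (\<lambda>q. f (q + D))"
    using nonneg \<open>D > 0\<close> by (intro summableI_nonneg_bounded) auto
  with \<open>\<not> summable f\<close> show False by (simp add: summable_iff_shift)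
qed

text \<open>The order of the choices matters: the pairs of primes depend only on \<open>e\<close>, then \<open>N\<close> is taken large
  in terms of their period, and the length \<open>B\<close> comes last.\<close>

lemma exists_block:
  fixes f :: "nat \<Rightarrow> real"
  assumes mono: "\<And>p q. 1 \<le> p \<Longrightarrow> p \<le> q \<Longrightarrow> f q \<le> f p"
    and nonneg: "\<And>q. 1 \<le> q \<Longrightarrow> 0 \<le> f q" and lim: "f \<longlonglongrightarrow> 0" and div: "\<not> summable f"
    and "e > 0"
  shows "\<exists>T V. finite T \<and> T \<subseteq> {Suc k..} \<and> 1 \<le> sum f T \<and> V \<in> sets lborel \<and>
    {\<alpha> \<in> {0..1}. \<exists>q\<in>T. int_dist (of_nat q * \<alpha>) < f q} \<subseteq> V \<and> emeasure lborel V \<le> ennreal e"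
proof -
  \<comment> \<open>The bound obtained below is \<open>4 * (2 * d + d)\<close>: density times a block sum of at most \<open>2\<close>, plus the error term.\<close>
  define d where "d = min 1 (e / 12)"
  have d: "d > 0" "d \<le> 1" "12 * d \<le> e" using \<open>e > 0\<close> by (auto simp: d_def)
  define a where "a n = nth_prime (2 * n + 1)" for n
  define b where "b n = nth_prime (2 * n)" for n
  obtain L where L: "(\<Prod>n<L. 1 - b n / (a n * (real (a n) + b n - 1))) \<le> d"
    using prime_pairs_product_small[OF \<open>d > 0\<close>] unfolding a_def b_def by blast
  have cop: "coprime (nth_prime i) (nth_prime j)" if "i \<noteq> j" for i j
    using that nth_prime_less[of i j] nth_prime_less[of j i]
    by (intro primes_coprime prime_nth_prime) (metis linorder_neqE_nat less_irrefl)
  interpret coprime_pairs "{..<L}" a b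
  proof
    show "0 < b j" "b j < a j" "coprime (a j) (b j)" for j
      using prime_gt_0_nat[OF prime_nth_prime] by (auto simp: a_def b_def nth_prime_less cop)
    have odd_even: "2 * i + 1 \<noteq> 2 * j" "2 * i \<noteq> 2 * j + 1" for i j :: nat by presburger+
    show "coprime (a i * b i) (a j * b j)" if "i \<noteq> j" for i j
      using that odd_even by (simp add: a_def b_def cop)
  qed simp
  have "(\<lambda>N. (real period + 1) * f N) \<longlonglongrightarrow> 0"
    using tendsto_mult_right_zero[OF lim] by simp
  then have "eventually (\<lambda>N. (real period + 1) * f N < d) sequentially"
    using d(1) by (rule order_tendstoD(2))
  then have "eventually (\<lambda>N. N \<ge> Suc k \<and> (real period + 1) * f N < d) sequentially"
    by (intro eventually_conj eventually_ge_at_top)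
  then obtain N where N: "N \<ge> Suc k" "(real period + 1) * f N < d"
    using eventually_happens'[OF sequentially_bot] by blast
  have "N > 0" using N by simp
  have "0 \<le> real period * f N" using nonneg[of N] N by simp
  then have fN: "f N \<le> 1" using N(2) d(2) by (simp add: algebra_simps)
  define u where "u m = f (N * m)" for m
  have u0: "0 \<le> u m" and u1: "u m \<le> 1" and u_mono: "u (Suc m) \<le> u m" if "m \<ge> 1" for m
  proof -
    have "N * m \<ge> N" "N * m \<ge> 1" using that \<open>N > 0\<close> by auto
    then show "0 \<le> u m" "u m \<le> 1" "u (Suc m) \<le> u m"
      using mono[of N "N * m"] fN \<open>N > 0\<close> by (auto simp: u_def intro!: nonneg mono)
  qed
  define s where "s B = (\<Sum>m = 1..B. u m * of_bool (admissible m))" for B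
  \<comment> \<open>The multiples of \<open>period\<close> are admissible and already give an infinite sum.\<close>
  have "\<exists>B. s B \<ge> 1"
  proof (rule ccontr)
    assume "\<not> ?thesis"
    then have s_less: "s B < 1" for B by (simp add: not_le)
    define D where "D = N * period"
    have "(\<Sum>j<K. f (D * Suc j)) \<le> 1" for K
    proof -
      have inj: "inj_on (\<lambda>j. period * Suc j) {..<K}"
        using period_pos by (auto intro!: inj_onI)
      have "(\<Sum>j<K. f (D * Suc j)) = (\<Sum>m\<in>(\<lambda>j. period * Suc j) ` {..<K}. u m * of_bool (admissible m))"
        by (subst sum.reindex[OF inj]) (auto simp: u_def D_def admissible_multiple mult.assoc simp del: mult_Suc_right)
      also have "\<dots> \<le> s (period * K)"
        unfolding s_def
      proof (rule sum_mono2)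
        show "(\<lambda>j. period * Suc j) ` {..<K} \<subseteq> {1..period * K}"
          using period_pos by (auto simp: Suc_le_eq simp del: mult_Suc_right)
      qed (auto intro: u0)
      finally show ?thesis using s_less[of "period * K"] by simp
    qed
    moreover have D: "D > 0" using \<open>N > 0\<close> period_pos by (simp add: D_def)
    ultimately have "summable (\<lambda>j. f (D * Suc j))"
      using nonneg by (intro summableI_nonneg_bounded) (auto simp: Suc_le_eq simp del: mult_Suc_right)
    with not_summable_multiples[OF mono nonneg div D] show False by simp
  qed
  then obtain B where B: "s B \<ge> 1" "\<And>B'. B' < B \<Longrightarrow> s B' < 1"
    unfolding exists_least_iff[of "\<lambda>B. s B \<ge> 1"] not_le by blast
  \<comment> \<open>The block sum was below \<open>1\<close> before the last term, and that term is at most \<open>1\<close>.\<close>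
  have "s B \<le> 2"
  proof (cases B)
    case (Suc n)
    have "s B = s n + u B * of_bool (admissible B)" by (simp add: s_def Suc)
    moreover have "u B * of_bool (admissible B) \<le> 1" using u1[of B] Suc by simp
    ultimately show ?thesis using B(2)[of n] Suc by simp
  qed (simp add: s_def)
  define T where "T = (\<lambda>m. N * m) ` {m \<in> {1..B}. admissible m}"
  obtain V where V: "V \<in> sets lborel"
    "{\<alpha> \<in> {0..1}. \<exists>n\<in>{1..B}. admissible n \<and> int_dist (of_nat (N * n) * \<alpha>) < f (N * n)} \<subseteq> V"
    "emeasure lborel V \<le> ennreal (4 * (\<Sum>m = 1..B. f (N * m) * (of_bool (admissible m) * new_density m)))"
    using hits_measure_le[where f = f and N = N and B = B, OF \<open>N > 0\<close> mono nonneg fN] by blast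
  have "4 * (\<Sum>m = 1..B. f (N * m) * (of_bool (admissible m) * new_density m))
      \<le> 4 * (d * s B + (real period + 1) * u 1)"
    using weighted_new_density_le[where u = u and e = d and B = B, OF u_mono u0 less_imp_le[OF d(1)] d(2) L]
    by (simp add: s_def u_def)
  also have "\<dots> \<le> 4 * (d * 2 + d)"
    using \<open>s B \<le> 2\<close> d N(2) by (intro mult_left_mono add_mono) (auto simp: u_def)
  also have "\<dots> \<le> e" using d by simp
  finally have V_le: "emeasure lborel V \<le> ennreal e"
    using V(3) by (meson ennreal_leI order_trans)
  have "inj_on (\<lambda>m. N * m) A" for A
    using \<open>N > 0\<close> by (intro inj_onI) simp
  then have "sum f T = (\<Sum>m | m \<in> {1..B} \<and> admissible m. u m)"
    unfolding T_def by (subst sum.reindex) (simp_all add: u_def)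
  also have "\<dots> = (\<Sum>m = 1..B. if admissible m then u m else 0)"
    by (rule sum.inter_filter) simp
  also have "\<dots> = s B"
    unfolding s_def by (intro sum.cong) auto
  finally have sum_T: "1 \<le> sum f T" using B(1) by simp
  have T_ge: "T \<subseteq> {Suc k..}"
  proof
    fix q assume "q \<in> T"
    then obtain m where "q = N * m" "m \<ge> 1" by (auto simp: T_def)
    then have "N \<le> q" by simp
    with N show "q \<in> {Suc k..}" by simp
  qed
  have fin_T: "finite T" by (simp add: T_def)
  have hits_V: "{\<alpha> \<in> {0..1}. \<exists>q\<in>T. int_dist (of_nat q * \<alpha>) < f q} \<subseteq> V"
  proof -
    have "(\<exists>q\<in>T. int_dist (of_nat q * \<alpha>) < f q) \<longleftrightarrow>
      (\<exists>n\<in>{1..B}. admissible n \<and> int_dist (of_nat (N * n) * \<alpha>) < f (N * n))" for \<alpha>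
      by (auto simp: T_def simp del: of_nat_mult)
    with V(2) show ?thesis by (simp only:)
  qed
  show ?thesis
    by (intro exI conjI) (rule fin_T T_ge sum_T V(1) hits_V V_le)+
qed

section \<open>Assembling the blocks\<close>

lemma infsum_ennreal_ge_sum:
  assumes "finite F" "F \<subseteq> A"
  shows "sum g F \<le> (\<Sum>\<^sub>\<infinity>x\<in>A. g x :: ennreal)"
  using assms by (subst nonneg_infsum_complete) (auto intro!: SUP_upper)

lemma infsum_ennreal_infinite_imp_not_summable:
  fixes f :: "nat \<Rightarrow> real"
  assumes nonneg: "\<And>q. 1 \<le> q \<Longrightarrow> 0 \<le> f q" and inf: "(\<Sum>\<^sub>\<infinity>q\<in>{1..}. ennreal (f q)) = \<infinity>"
  shows "\<not> summable f"
proof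
  assume "summable f"
  then have sum: "summable (\<lambda>n. f (Suc n))" by (simp add: summable_Suc_iff)
  have "(\<Sum>\<^sub>\<infinity>q\<in>{1..}. ennreal (f q)) \<le> ennreal (\<Sum>n. f (Suc n))"
  proof (subst nonneg_infsum_complete, simp, rule SUP_least)
    fix F :: "nat set" assume "F \<in> {F. finite F \<and> F \<subseteq> {1..}}"
    then have F: "finite F" "F \<subseteq> {1..}" by auto
    then obtain n where n: "F \<subseteq> {1..n}"
      by (metis finite_nat_set_iff_bounded_le atLeastAtMost_iff atLeast_iff subset_iff)
    have "sum f F \<le> (\<Sum>q = 1..n. f q)"
      using n nonneg by (intro sum_mono2) auto
    also have "\<dots> = (\<Sum>i<n. f (Suc i))"
      by (simp add: sum.atLeast1_atMost_eq)
    also have "\<dots> \<le> (\<Sum>n. f (Suc n))"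
      using nonneg by (intro sum_le_suminf sum) auto
    finally have "sum f F \<le> (\<Sum>n. f (Suc n))" .
    moreover have "(\<Sum>q\<in>F. ennreal (f q)) = ennreal (sum f F)"
      using F nonneg by (intro sum_ennreal) auto
    ultimately show "(\<Sum>q\<in>F. ennreal (f q)) \<le> ennreal (\<Sum>n. f (Suc n))"
      by (simp add: ennreal_leI)
  qed
  with inf show False by (simp add: top_unique)
qed

theorem theorem1p2:
  fixes f :: "nat \<Rightarrow> real"
  assumes "\<And>q. q \<in> {1..} \<Longrightarrow> 0 \<le> f q"
    and "antimono_on {1..} f"
    and "f \<longlonglongrightarrow> 0"
    and "(\<Sum>\<^sub>\<infinity>q\<in>{1..}. ennreal (f q)) = \<infinity>"
  shows "\<exists>S \<subseteq> {1..}. (\<Sum>\<^sub>\<infinity>q\<in>S. ennreal (f q)) = \<infinity> \<and>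
           approx_set (\<lambda>q. f q * indicator S q) \<in> null_sets lebesgue"
proof -
  have nonneg: "0 \<le> f q" if "1 \<le> q" for q using assms(1) that by simp
  have mono: "f q \<le> f p" if "1 \<le> p" "p \<le> q" for p q
    using monotone_onD[OF assms(2)] that by simp
  have div: "\<not> summable f"
    using infsum_ennreal_infinite_imp_not_summable[OF nonneg assms(4)] .
  have "\<forall>k. \<exists>T V. finite T \<and> T \<subseteq> {Suc k..} \<and> 1 \<le> sum f T \<and> V \<in> sets lborel \<and>
    {\<alpha> \<in> {0..1}. \<exists>q\<in>T. int_dist (of_nat q * \<alpha>) < f q} \<subseteq> V \<and>
    emeasure lborel V \<le> ennreal ((1 / 2) ^ k)"
  proof
    fix k
    show "\<exists>T V. finite T \<and> T \<subseteq> {Suc k..} \<and> 1 \<le> sum f T \<and> V \<in> sets lborel \<and>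
      {\<alpha> \<in> {0..1}. \<exists>q\<in>T. int_dist (of_nat q * \<alpha>) < f q} \<subseteq> V \<and>
      emeasure lborel V \<le> ennreal ((1 / 2) ^ k)"
      by (rule exists_block[where f = f, OF mono nonneg assms(3) div]) simp_all
  qed
  then have "\<exists>T V. \<forall>k. finite (T k) \<and> T k \<subseteq> {Suc k..} \<and> 1 \<le> sum f (T k) \<and> V k \<in> sets lborel \<and>
    {\<alpha> \<in> {0..1}. \<exists>q\<in>T k. int_dist (of_nat q * \<alpha>) < f q} \<subseteq> V k \<and>
    emeasure lborel (V k) \<le> ennreal ((1 / 2) ^ k)"
    unfolding choice_iff .
  then obtain T V where TV: "\<forall>k. finite (T k) \<and> T k \<subseteq> {Suc k..} \<and> 1 \<le> sum f (T k) \<and>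
    V k \<in> sets lborel \<and>
    {\<alpha> \<in> {0..1}. \<exists>q\<in>T k. int_dist (of_nat q * \<alpha>) < f q} \<subseteq> V k \<and>
    emeasure lborel (V k) \<le> ennreal ((1 / 2) ^ k)"
    by (elim exE)
  have T: "finite (T k)" "T k \<subseteq> {Suc k..}" "1 \<le> sum f (T k)"
    and V: "V k \<in> sets lborel"
    and hits: "{\<alpha> \<in> {0..1}. \<exists>q\<in>T k. int_dist (of_nat q * \<alpha>) < f q} \<subseteq> V k"
    and V_le: "emeasure lborel (V k) \<le> ennreal ((1 / 2) ^ k)" for k
    using TV[rule_format, of k] by simp_all
  define S where "S = (\<Union>k. T k)"
  have S: "S \<subseteq> {1..}" unfolding S_def using T(2) by fastforce
  \<comment> \<open>The blocks may overlap; a block starting beyond \<open>F\<close> is disjoint from it and adds at least \<open>1\<close>.\<close>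
  have "\<exists>F. finite F \<and> F \<subseteq> S \<and> real n \<le> sum f F" for n
  proof (induction n)
    case 0
    show ?case by (intro exI[of _ "{}"]) simp
  next
    case (Suc n)
    then obtain F where F: "finite F" "F \<subseteq> S" "real n \<le> sum f F" by blast
    then obtain k where k: "\<forall>q\<in>F. q \<le> k"
      using finite_nat_set_iff_bounded_le by blast
    have "F \<inter> T k = {}" using k T(2)[of k] by fastforce
    then have "sum f (F \<union> T k) = sum f F + sum f (T k)"
      using F T(1) by (intro sum.union_disjoint) auto
    then have "real (Suc n) \<le> sum f (F \<union> T k)" using F(3) T(3)[of k] by simp
    moreover have "F \<union> T k \<subseteq> S" "finite (F \<union> T k)"
      using F T(1) by (auto simp: S_def)
    ultimately show ?case by blast
  qed
  then have large: "of_nat n \<le> (\<Sum>\<^sub>\<infinity>q\<in>S. ennreal (f q))" for n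
  proof -
    obtain F where F: "finite F" "F \<subseteq> S" "real n \<le> sum f F"
      using \<open>\<exists>F. finite F \<and> F \<subseteq> S \<and> real n \<le> sum f F\<close> by blast
    have "of_nat n = ennreal (real n)" by (simp add: ennreal_of_nat_eq_real_of_nat)
    also have "\<dots> \<le> ennreal (sum f F)" using F by (intro ennreal_leI)
    also have "\<dots> = (\<Sum>q\<in>F. ennreal (f q))"
      using F S nonneg by (intro sum_ennreal[symmetric]) auto
    also have "\<dots> \<le> (\<Sum>\<^sub>\<infinity>q\<in>S. ennreal (f q))"
      using F by (intro infsum_ennreal_ge_sum)
    finally show ?thesis .
  qed
  have inf: "(\<Sum>\<^sub>\<infinity>q\<in>S. ennreal (f q)) = \<infinity>"
  proof (rule ccontr)
    assume "\<not> ?thesis"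
    then obtain n where "(\<Sum>\<^sub>\<infinity>q\<in>S. ennreal (f q)) < of_nat n"
      using ennreal_Ex_less_of_nat by (auto simp: less_top)
    with large[of n] show False by simp
  qed
  have "limsup V \<in> null_sets lborel"
  proof (rule borel_cantelli_limsup1)
    show "V k \<in> sets lborel" for k by (rule V)
    show fin: "emeasure lborel (V k) < \<infinity>" for k
      by (rule le_less_trans[OF V_le]) simp
    have "measure lborel (V k) \<le> (1 / 2) ^ k" for k
      unfolding measure_def using V_le[of k] by (rule enn2real_leI[rotated]) simp
    then show "summable (\<lambda>k. measure lborel (V k))"
      by (intro summable_comparison_test'[OF summable_geometric[of "1 / 2 :: real"]]) simp_all
  qed
  then have null: "limsup V \<in> null_sets lebesgue"
    by (rule null_sets_completionI)
  have "approx_set (\<lambda>q. f q * indicator S q) \<subseteq> limsup V"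
  proof
    fix \<alpha> assume "\<alpha> \<in> approx_set (\<lambda>q. f q * indicator S q)"
    then have \<alpha>: "\<alpha> \<in> {0..1}"
      and infin: "infinite {q \<in> {1..}. int_dist (of_nat q * \<alpha>) < f q * indicator S q}"
      by (auto simp: approx_set_def)
    have "\<exists>k\<ge>n. \<alpha> \<in> V k" for n
    proof -
      have "finite (\<Union>k<n. T k)" using T(1) by simp
      then have "\<not> {q \<in> {1..}. int_dist (of_nat q * \<alpha>) < f q * indicator S q} \<subseteq> (\<Union>k<n. T k)"
        using infin finite_subset by blast
      then obtain q where q: "q \<notin> (\<Union>k<n. T k)" "int_dist (of_nat q * \<alpha>) < f q * indicator S q"
        by blast
      then have "q \<in> S" using int_dist_nonneg[of "of_nat q * \<alpha>"] by (cases "q \<in> S") auto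
      then obtain k where k: "q \<in> T k" by (auto simp: S_def)
      with q have "k \<ge> n" by (auto simp: not_less[symmetric])
      moreover have "int_dist (of_nat q * \<alpha>) < f q" using q(2) \<open>q \<in> S\<close> by simp
      then have "\<alpha> \<in> V k" using hits[of k] \<alpha> k by blast
      ultimately show ?thesis by blast
    qed
    then show "\<alpha> \<in> limsup V"
      by (auto simp: limsup_INF_SUP)
  qed
  with null have "approx_set (\<lambda>q. f q * indicator S q) \<in> null_sets lebesgue"
    by (metis null_sets_completion_subset)
  with S inf show ?thesis by blast
qed

end
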